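(* For every integer $k \ge 3$ there exists $N$ such that for all $n \ge N$ we have $g_k(n) \le h_k(n) < 4 n^{1 - \frac{1}{2^{k-2}}}$.
   Context: For positive integers $n$ and $k \ge 3$, $g_k(n)$ denotes the smallest integer such that for every set $A \subseteq \{1, 2, \ldots, 2n\}$ with $|A| \ge n + g_k(n)$ there exist pairwise distinct integers $b_1, \ldots, b_k$ (arbitrary integers, not required to be positive or to lie in $A$) with $b_i + b_j \in A$ for all $1 \le i < j \le k$. Likewise $h_k(n)$ denotes the smallest integer such that for every set $A \subseteq \{1, 2, \ldots, 2n\}$ with $|A| \ge n + h_k(n)$ there exist $k$ pairwise distinct positive integers $b_1, \ldots, b_k$ with $b_i + b_j \in A$ for all $1 \le i < j \le k$. *)

theory Defs
  imports Complex_Main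
begin

definition pairwise_sums_in :: "nat \<Rightarrow> (nat \<Rightarrow> int) \<Rightarrow> int set \<Rightarrow> bool" where
  "pairwise_sums_in k b A \<longleftrightarrow>
     inj_on b {1..k} \<and> (\<forall>i j. 1 \<le> i \<and> i < j \<and> j \<le> k \<longrightarrow> b i + b j \<in> A)"

text \<open>For \<open>k \<ge> 3\<close> the minima below exist: \<open>m = n + 1\<close> is vacuously admissible, and no \<open>m \<le> 0\<close> is,
  since among any three integers two have an even sum, so the set of odd numbers up to \<open>2 n\<close>
  is a counterexample.\<close>

definition g_thr :: "nat \<Rightarrow> nat \<Rightarrow> int" where
  "g_thr k n = (LEAST m::int. \<forall>A \<subseteq> {1..2 * int n}. int (card A) \<ge> int n + m \<longrightarrow>
     (\<exists>b. pairwise_sums_in k b A))"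

definition h_thr :: "nat \<Rightarrow> nat \<Rightarrow> int" where
  "h_thr k n = (LEAST m::int. \<forall>A \<subseteq> {1..2 * int n}. int (card A) \<ge> int n + m \<longrightarrow>
     (\<exists>b. (\<forall>i\<in>{1..k}. b i > 0) \<and> pairwise_sums_in k b A))"

end

theory Submission
  imports Defs
begin

text \<open>At least \<open>m\<close> members of \<open>A\<close> are even, since only \<open>n\<close> numbers up to \<open>2 n\<close> are odd. If
  \<open>m\<close> is about \<open>4 n\<^sup>1\<^sup>-\<^sup>\<epsilon>\<close> with \<open>\<epsilon> = 2\<^sup>2\<^sup>-\<^sup>k\<close>, then the halves of these even members contain a Hilbert
  cube \<open>a + \<Sum>T\<close>, \<open>T \<subseteq> D\<close>, with \<open>k - 1\<close> distinct positive generators. The numbers \<open>a\<close> and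
  \<open>a + 2 x\<close>, \<open>x \<in> D\<close>, then have all their pairwise sums in \<open>A\<close>.\<close>

section \<open>Popular differences by pigeonhole\<close>

text \<open>With \<open>s = card S\<close>, there are \<open>s * (s - 1) / 2\<close> pairs
  \<open>x < y\<close> in \<open>S\<close>. Each difference in \<open>D\<close> accounts for at most
  \<open>s\<close> of them, so at least \<open>s * (s - 1 - 2 * K) / 2\<close> pairs are spread over
  at most \<open>n\<close> fresh differences, and one of these occurs at least the average number of
  times.\<close>

lemma exists_popular_difference:
  fixes S D :: "int set" and n K :: nat
  assumes S: "S \<subseteq> {1..int n}" and D: "finite D" "card D \<le> K"
    and big: "card S > 1 + 2 * K"
  shows "\<exists>d>0. d \<notin> D \<and>
    int (card S) * (int (card S) - 1 - 2 * int K) \<le> 2 * int n * int (card {x\<in>S. x + d \<in> S})"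
proof (rule ccontr)
  assume neg: "\<not> ?thesis"
  define s q where "s = int (card S)" and "q = s * (s - 1 - 2 * int K)"
  define c where "c = (\<lambda>d. int (card {x\<in>S. x + d \<in> S}))"
  have fin: "finite S" using S finite_subset by blast
  have q: "q > 0" using big unfolding q_def s_def by (intro mult_pos_pos) auto
  have n: "n > 0" using S big by (cases n) auto
  define P where "P = {p\<in>S \<times> S. fst p < snd p}"
  have finP: "finite P" unfolding P_def using fin by simp
  \<comment> \<open>The ordered pairs split into \<open>P\<close>, its mirror image and the
    diagonal.\<close>
  have "S \<times> S \<subseteq> P \<union> prod.swap ` P \<union> (\<lambda>x. (x, x)) ` S"
    unfolding P_def by (force simp: image_iff)
  then have "card (S \<times> S) \<le> card (P \<union> prod.swap ` P \<union> (\<lambda>x. (x, x)) ` S)"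
    using fin finP by (intro card_mono) auto
  also have "\<dots> \<le> card P + card P + card S"
    using card_Un_le[of "P \<union> prod.swap ` P" "(\<lambda>x. (x, x)) ` S"] card_Un_le[of P "prod.swap ` P"]
      card_image_le[OF finP, of prod.swap] card_image_le[OF fin, of "\<lambda>x. (x, x)"] by linarith
  finally have "int (card S * card S) \<le> int (2 * card P + card S)"
    by (simp only: of_nat_le_iff card_cartesian_product mult_2)
  then have 1: "s * s \<le> 2 * int (card P) + s" by (simp add: s_def)
  have "P \<subseteq> (\<Union>d\<in>{1..int n}. (\<lambda>x. (x, x + d)) ` {x\<in>S. x + d \<in> S})"
  proof
    fix p assume "p \<in> P"
    then obtain x y where xy: "p = (x, y)" "x \<in> S" "y \<in> S" "x < y" unfolding P_def by force
    then have "1 \<le> x" "y \<le> int n" using S by auto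
    then have "y - x \<in> {1..int n}" using xy by auto
    moreover have "x \<in> {z\<in>S. z + (y - x) \<in> S}" "p = (x, x + (y - x))" using xy by auto
    ultimately show "p \<in> (\<Union>d\<in>{1..int n}. (\<lambda>x. (x, x + d)) ` {x\<in>S. x + d \<in> S})" by blast
  qed
  then have "card P \<le> card (\<Union>d\<in>{1..int n}. (\<lambda>x. (x, x + d)) ` {x\<in>S. x + d \<in> S})"
    using fin by (intro card_mono) auto
  also have "\<dots> \<le> (\<Sum>d\<in>{1..int n}. card ((\<lambda>x. (x, x + d)) ` {x\<in>S. x + d \<in> S}))"
    by (intro card_UN_le) simp
  also have "\<dots> \<le> (\<Sum>d\<in>{1..int n}. card {x\<in>S. x + d \<in> S})"
    using fin by (intro sum_mono card_image_le) simp
  finally have 2: "int (card P) \<le> (\<Sum>d\<in>{1..int n}. c d)"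
    unfolding c_def of_nat_sum[symmetric] of_nat_le_iff .
  have "(\<Sum>d\<in>{1..int n} \<inter> D. c d) \<le> (\<Sum>d\<in>{1..int n} \<inter> D. s)"
    unfolding c_def s_def using fin by (intro sum_mono) (auto intro: card_mono)
  also have "\<dots> = s * int (card ({1..int n} \<inter> D))" by simp
  also have "\<dots> \<le> s * int K"
    using D card_mono[of D "{1..int n} \<inter> D"] by (intro mult_left_mono) (auto simp: s_def)
  finally have 3: "(\<Sum>d\<in>{1..int n} \<inter> D. c d) \<le> s * int K" .
  \<comment> \<open>Over the integers the negated claim reads
    \<open>2 * n * c d \<le> q - 1\<close>. This lost unit yields the final contradiction, and
    \<open>q - 1 \<ge> 0\<close> permits bounding the number of fresh differences by
    \<open>n\<close>.\<close>
  have "2 * int n * (\<Sum>d\<in>{1..int n} - D. c d) \<le> (\<Sum>d\<in>{1..int n} - D. q - 1)"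
    unfolding sum_distrib_left
  proof (intro sum_mono)
    fix d assume "d \<in> {1..int n} - D"
    then show "2 * int n * c d \<le> q - 1" using neg unfolding c_def q_def s_def by force
  qed
  also have "\<dots> = int (card ({1..int n} - D)) * (q - 1)" by simp
  also have "\<dots> \<le> int n * (q - 1)"
    using q card_mono[of "{1..int n}" "{1..int n} - D"] by (intro mult_right_mono) auto
  finally have "int n * (2 * (\<Sum>d\<in>{1..int n} - D. c d)) \<le> int n * (q - 1)"
    by (simp add: algebra_simps)
  then have 4: "2 * (\<Sum>d\<in>{1..int n} - D. c d) \<le> q - 1" using n by simp
  have "(\<Sum>d\<in>{1..int n}. c d) = (\<Sum>d\<in>{1..int n} \<inter> D. c d) + (\<Sum>d\<in>{1..int n} - D. c d)"
    by (rule sum.Int_Diff) simp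
  then have "s * s \<le> 2 * (s * int K) + (q - 1) + s" using 1 2 3 4 by linarith
  then show False unfolding q_def by (simp add: algebra_simps)
qed

section \<open>Hilbert cubes and their base points\<close>

text \<open>The base points of all Hilbert cubes in \<open>S\<close> with generator set
  \<open>D\<close>. Keeping every base point, not just one, lets the pigeonhole step be applied
  again to this set.\<close>

definition cube_bases :: "int set \<Rightarrow> int set \<Rightarrow> int set" where
  "cube_bases S D = {a. \<forall>T\<subseteq>D. a + \<Sum>T \<in> S}"

lemma cube_bases_empty [simp]: "cube_bases S {} = S"
  by (simp add: cube_bases_def)

lemma cube_bases_subset: "cube_bases S D \<subseteq> S"
  unfolding cube_bases_def using empty_subsetI by fastforce

text \<open>Subsets of \<open>insert d D\<close> are sorted by whether they contain
  \<open>d\<close>. The right-hand side is the very set whose size a popular difference bounds from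
  below.\<close>

lemma cube_bases_insert:
  assumes "finite D" "d \<notin> D"
  shows "cube_bases S (insert d D) = {a \<in> cube_bases S D. a + d \<in> cube_bases S D}"
proof -
  have "(\<forall>T\<subseteq>insert d D. a + \<Sum>T \<in> S) \<longleftrightarrow>
    (\<forall>T\<subseteq>D. a + \<Sum>T \<in> S) \<and> (\<forall>T\<subseteq>D. a + \<Sum>(insert d T) \<in> S)" for a
  proof (intro iffI allI impI conjI)
    fix T assume *: "(\<forall>T\<subseteq>D. a + \<Sum>T \<in> S) \<and> (\<forall>T\<subseteq>D. a + \<Sum>(insert d T) \<in> S)"
      and T: "T \<subseteq> insert d D"
    show "a + \<Sum>T \<in> S"
    proof (cases "d \<in> T")
      case True
      then have "insert d (T - {d}) = T" "T - {d} \<subseteq> D" using T by auto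
      then show ?thesis using * by metis
    qed (use * T in blast)
  qed (meson insert_mono subset_insertI2)+
  moreover have "\<Sum>(insert d T) = d + \<Sum>T" if "T \<subseteq> D" for T
    using that assms by (subst sum.insert) (auto intro: finite_subset)
  ultimately show ?thesis unfolding cube_bases_def by (auto simp: add.assoc)
qed

text \<open>Each step squares the density \<open>card S / n\<close> up to a constant; the factor \<open>3/8\<close> instead of the
  asymptotic \<open>1/2\<close> absorbs the diagonal pairs and the differences that are already in use.\<close>

lemma hilbert_cube_iteration:
  fixes S :: "int set" and n K l j :: nat and \<gamma> :: real
  assumes S: "S \<subseteq> {1..int n}" and "n > 0" and "l \<le> K" and "\<gamma> \<ge> 0"
    and start: "real (card S) \<ge> 8 / 3 * real n * \<gamma>"
    and large: "\<And>i. i < l \<Longrightarrow> 8 / 3 * real n * \<gamma> ^ (2 ^ i) \<ge> 4 * (1 + 2 * real K)"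
    and "j \<le> l"
  shows "\<exists>D. finite D \<and> card D = j \<and> D \<subseteq> {0<..} \<and>
    real (card (cube_bases S D)) \<ge> 8 / 3 * real n * \<gamma> ^ (2 ^ j)"
  using \<open>j \<le> l\<close>
proof (induction j)
  case 0
  show ?case using start by (intro exI[of _ "{}"]) simp
next
  case (Suc j)
  then obtain D where D: "finite D" "card D = j" "D \<subseteq> {0<..}"
    and b: "real (card (cube_bases S D)) \<ge> 8 / 3 * real n * \<gamma> ^ (2 ^ j)" by auto
  let ?s = "real (card (cube_bases S D))"
  have lg: "?s \<ge> 4 * (1 + 2 * real K)" using large[of j] b Suc.prems by linarith
  have "real (1 + 2 * K) < ?s" using lg by simp
  then have "card (cube_bases S D) > 1 + 2 * K" by (simp only: of_nat_less_iff)
  moreover have "cube_bases S D \<subseteq> {1..int n}" using S cube_bases_subset by blast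
  moreover have "card D \<le> K" using D Suc.prems \<open>l \<le> K\<close> by simp
  ultimately obtain d where d: "d > 0" "d \<notin> D" and
    "int (card (cube_bases S D)) * (int (card (cube_bases S D)) - 1 - 2 * int K)
      \<le> 2 * int n * int (card (cube_bases S (insert d D)))"
    using exists_popular_difference[of "cube_bases S D" n D K] D(1)
    by (auto simp: cube_bases_insert)
  then have "of_int (int (card (cube_bases S D)) * (int (card (cube_bases S D)) - 1 - 2 * int K))
      \<le> (of_int (2 * int n * int (card (cube_bases S (insert d D)))) :: real)"
    by (simp only: of_int_le_iff)
  then have c: "?s * (?s - 1 - 2 * real K) \<le> 2 * real n * real (card (cube_bases S (insert d D)))"
    by simp
  \<comment> \<open>By \<open>lg\<close>, the loss \<open>1 + 2 * K\<close> is at most a quarter of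
    \<open>?s\<close>.\<close>
  have "?s * (3 / 4 * ?s) \<le> ?s * (?s - 1 - 2 * real K)"
    using lg by (intro mult_left_mono) auto
  moreover have "(8 / 3 * real n * \<gamma> ^ (2 ^ j)) * (8 / 3 * real n * \<gamma> ^ (2 ^ j)) \<le> ?s * ?s"
    using b \<open>\<gamma> \<ge> 0\<close> by (intro mult_mono) auto
  ultimately have "3 / 4 * ((8 / 3 * real n * \<gamma> ^ (2 ^ j)) * (8 / 3 * real n * \<gamma> ^ (2 ^ j)))
      \<le> 2 * real n * real (card (cube_bases S (insert d D)))"
    using c by linarith
  \<comment> \<open>The constant \<open>8 / 3\<close> is the fixed point of
    \<open>c \<mapsto> 3 / 8 * c\<^sup>2\<close>, so it survives each step unchanged while
    \<open>\<gamma> ^ (2 ^ j)\<close> is squared.\<close>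
  moreover have "3 / 4 * ((8 / 3 * real n * \<gamma> ^ (2 ^ j)) * (8 / 3 * real n * \<gamma> ^ (2 ^ j)))
      = 2 * real n * (8 / 3 * real n * \<gamma> ^ (2 ^ Suc j))"
    by (simp add: power_mult power2_eq_square mult.commute[of 2])
  ultimately have "8 / 3 * real n * \<gamma> ^ (2 ^ Suc j) \<le> real (card (cube_bases S (insert d D)))"
    using \<open>n > 0\<close> by (simp add: mult_le_cancel_left)
  then show ?case using D d by (intro exI[of _ "insert d D"]) auto
qed

text \<open>The last generator only has to leave one base point, so no squaring is paid for it. The
  distances from the least base point to the others are positive, distinct and too many to lie all
  in \<open>D\<close>.\<close>

lemma hilbert_cube_extend:
  assumes "finite S" "finite D" "card (cube_bases S D) \<ge> card D + 2"
  shows "\<exists>d>0. d \<notin> D \<and> cube_bases S (insert d D) \<noteq> {}"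
proof -
  let ?B = "cube_bases S D"
  define a where "a = Min ?B"
  have fin: "finite ?B" by (rule finite_subset[OF cube_bases_subset assms(1)])
  have "?B \<noteq> {}" using assms by auto
  then have a: "a \<in> ?B" "\<And>y. y \<in> ?B \<Longrightarrow> a \<le> y" unfolding a_def using fin by auto
  have "card ((\<lambda>y. y - a) ` (?B - {a})) = card ?B - 1"
    using a fin by (subst card_image) (auto simp: inj_on_def)
  then have "\<not> (\<lambda>y. y - a) ` (?B - {a}) \<subseteq> D"
    using assms card_mono[of D "(\<lambda>y. y - a) ` (?B - {a})"] by auto
  then obtain y where y: "y \<in> ?B" "y \<noteq> a" "y - a \<notin> D" by blast
  then have "a \<in> cube_bases S (insert (y - a) D)" using a assms by (simp add: cube_bases_insert)
  moreover have "y - a > 0" using a(2)[of y] y by simp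
  ultimately show ?thesis using y by blast
qed

text \<open>The left side bounds the number of bases left after \<open>l\<close> steps;
  \<open>l + 2\<close> is what \<open>hilbert_cube_extend\<close> requires. The proof uses
  \<open>(7 / 5)\<^sup>2 = 1 + 24 / 25\<close>.\<close>

lemma Bernoulli_bound_double_exp: "l \<ge> 1 \<Longrightarrow> 8 / 3 * (7 / 5 :: real) ^ (2 ^ l) \<ge> real l + 2"
proof -
  assume "l \<ge> 1"
  then have "2 * l \<le> 2 ^ l"
    by (induction l rule: nat_induct_at_least) auto
  then have "(7 / 5 :: real) ^ (2 * l) \<le> (7 / 5) ^ (2 ^ l)" by (intro power_increasing) auto
  moreover have "(7 / 5 :: real) ^ (2 * l) = (1 + 24 / 25) ^ l"
    by (simp add: power_mult power2_eq_square)
  moreover have "1 + real l * (24 / 25) \<le> (1 + 24 / 25) ^ l" by (rule Bernoulli_inequality) simp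
  ultimately show ?thesis by simp
qed

lemma hilbert_cube:
  fixes S :: "int set" and n k :: nat
  assumes "k \<ge> 3" and S: "S \<subseteq> {1..int n}" and N: "n \<ge> (8 * k + 4)\<^sup>2"
    and cS: "real (card S) \<ge> 4 * real n powr (1 - 1 / 2 ^ (k - 2)) - 1"
  shows "\<exists>D. finite D \<and> card D = k - 1 \<and> D \<subseteq> {0<..} \<and> cube_bases S D \<noteq> {}"
proof -
  define l where "l = k - 2"
  \<comment> \<open>This density makes \<open>n * \<beta>\<close> the power of \<open>n\<close> in
    the hypothesis and \<open>n * \<beta> ^ (2 ^ l) = 1\<close>.\<close>
  define \<beta> where "\<beta> = real n powr (- 1 / 2 ^ l)"
  have "n > 0" using N by (cases n) auto
  then have n: "real n \<ge> 1" "n > 0" by auto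
  have \<beta>0: "\<beta> > 0" using n by (simp add: \<beta>_def)
  have \<beta>p: "\<beta> ^ (2 ^ i) = real n powr (- (2 ^ i) / 2 ^ l)" for i
    using n unfolding \<beta>_def by (simp add: powr_power)
  have n\<beta>: "real n powr (1 - 1 / 2 ^ l) = real n * \<beta>"
    using n powr_add[of "real n" 1 "- 1 / 2 ^ l"] by (simp add: \<beta>_def)
  have sq: "real n powr (1 / 2) \<ge> 8 * real k + 4"
  proof -
    have "real ((8 * k + 4)\<^sup>2) \<le> real n" using N by (simp only: of_nat_le_iff)
    then show ?thesis using n by (auto simp: powr_half_sqrt intro!: real_le_rsqrt)
  qed
  have low: "real n * \<beta> ^ (2 ^ i) \<ge> 8 * real k + 4" if "i < l" for i
  proof -
    have "(2::real) ^ Suc i \<le> 2 ^ l" using that by (intro power_increasing) auto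
    then have "(1::real) / 2 \<le> 1 + - (2 ^ i) / 2 ^ l" by (simp add: field_simps)
    then have "real n powr (1 / 2) \<le> real n powr (1 + - (2 ^ i) / 2 ^ l)"
      using n by (intro powr_mono) auto
    also have "\<dots> = real n * \<beta> ^ (2 ^ i)" using n unfolding \<beta>p powr_add by simp
    finally show ?thesis using sq by linarith
  qed
  have l: "l \<ge> 1" "l \<le> k" "real l + 2 = real k" "k = l + 2" using assms by (auto simp: l_def)
  have big: "real n * \<beta> \<ge> 28" using low[of 0] l assms by simp
  \<comment> \<open>Since \<open>8 / 3 * 7 / 5 < 4\<close>, the slack absorbs the \<open>- 1\<close>
    in the hypothesis; since \<open>7 / 5 > 1\<close>, the final count grows doubly exponentially in
    \<open>l\<close>.\<close>
  have "\<exists>D. finite D \<and> card D = l \<and> D \<subseteq> {0<..} \<and>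
    real (card (cube_bases S D)) \<ge> 8 / 3 * real n * (7 / 5 * \<beta>) ^ (2 ^ l)"
  proof (rule hilbert_cube_iteration[where K = k and l = l])
    show "8 / 3 * real n * (7 / 5 * \<beta>) \<le> real (card S)"
      using cS big n\<beta> unfolding l_def by simp
    fix i assume "i < l"
    have "real n * \<beta> ^ (2 ^ i) \<le> real n * (7 / 5 * \<beta>) ^ (2 ^ i)"
      using \<beta>0 by (intro mult_left_mono power_mono) auto
    then show "4 * (1 + 2 * real k) \<le> 8 / 3 * real n * (7 / 5 * \<beta>) ^ (2 ^ i)"
      using low[OF \<open>i < l\<close>] by simp
  qed (use S n l \<beta>0 in auto)
  then obtain D where D: "finite D" "card D = l" "D \<subseteq> {0<..}"
    and c: "real (card (cube_bases S D)) \<ge> 8 / 3 * real n * (7 / 5 * \<beta>) ^ (2 ^ l)" by blast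
  have "real n * \<beta> ^ (2 ^ l) = 1" using n by (simp add: \<beta>p powr_minus)
  moreover have "8 / 3 * real n * (7 / 5 * \<beta>) ^ (2 ^ l)
      = 8 / 3 * (7 / 5) ^ (2 ^ l) * (real n * \<beta> ^ (2 ^ l))"
    unfolding power_mult_distrib by (simp only: mult.assoc mult.left_commute)
  ultimately have "8 / 3 * real n * (7 / 5 * \<beta>) ^ (2 ^ l) = 8 / 3 * (7 / 5) ^ (2 ^ l)"
    by simp
  then have "real (card (cube_bases S D)) \<ge> real (l + 2)"
    using c Bernoulli_bound_double_exp[OF l(1)] by simp
  then have "card (cube_bases S D) \<ge> card D + 2" using D by (simp only: of_nat_le_iff)
  moreover have "finite S" using S finite_subset by blast
  ultimately obtain d where "d > 0" "d \<notin> D" "cube_bases S (insert d D) \<noteq> {}"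
    using hilbert_cube_extend D by metis
  then show ?thesis using D l by (intro exI[of _ "insert d D"]) auto
qed

section \<open>From cubes of halves to pairwise sums\<close>

lemma card_halves:
  fixes A :: "int set" and n :: nat
  assumes "A \<subseteq> {1..2 * int n}"
  shows "card A \<le> n + card {e. 2 * e \<in> A}"
proof -
  let ?E = "{e. 2 * e \<in> A}" and ?O = "(\<lambda>i. 2 * i - 1) ` {1..int n}"
  have "?E \<subseteq> {1..int n}" using assms by fastforce
  then have fin: "finite ?E" using finite_subset by blast
  have "A \<subseteq> ?O \<union> (*) 2 ` ?E"
  proof
    fix x assume x: "x \<in> A"
    show "x \<in> ?O \<union> (*) 2 ` ?E"
    proof (cases "even x")
      case True
      then show ?thesis using x by (auto elim!: evenE)
    next
      case False
      then obtain i where "x = 2 * i + 1" by (auto elim: oddE)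
      then have "x = 2 * (i + 1) - 1" "i + 1 \<in> {1..int n}" using x assms by fastforce+
      then show ?thesis by blast
    qed
  qed
  then have "card A \<le> card (?O \<union> (*) 2 ` ?E)" using fin by (intro card_mono) auto
  also have "\<dots> \<le> card ?O + card ((*) 2 ` ?E)" by (rule card_Un_le)
  also have "\<dots> \<le> card {1..int n} + card ?E"
    using fin by (intro add_mono card_image_le) auto
  finally show ?thesis by simp
qed

lemma pairwise_sums_of_cube:
  fixes A D :: "int set" and a :: int
  assumes D: "finite D" "card D = k - 1" "D \<subseteq> {0<..}" and "k \<ge> 1"
    and a: "a \<in> cube_bases {e. 2 * e \<in> A} D" "a > 0"
  shows "\<exists>b. (\<forall>i\<in>{1..k}. b i > 0) \<and> pairwise_sums_in k b A"
proof -
  have "card (insert 0 D) = k" using D \<open>k \<ge> 1\<close> by (subst card_insert_disjoint) auto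
  then obtain h where h: "bij_betw h {1..k} (insert 0 D)"
    using finite_same_card_bij[of "{1..k}" "insert 0 D"] D by auto
  have hD: "h i \<in> insert 0 D" if "i \<in> {1..k}" for i using h that by (auto simp: bij_betw_def)
  have inj: "inj_on h {1..k}" using h by (simp add: bij_betw_def)
  let ?b = "\<lambda>i. a + 2 * h i"
  have "?b i > 0" if "i \<in> {1..k}" for i using hD[OF that] D(3) a(2) by fastforce
  moreover have "?b i + ?b j \<in> A" if ij: "1 \<le> i" "i < j" "j \<le> k" for i j
  proof -
    have "h i \<noteq> h j" using inj_onD[OF inj, of i j] ij by auto
    \<comment> \<open>The value 0 of \<open>h\<close> stands for the number \<open>a\<close> itself.
      Deleting it leaves a subset of \<open>D\<close> with one or two elements and does not change
      the sum.\<close>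
    then have "\<Sum>({h i, h j} - {0}) = h i + h j" by (simp add: sum_diff1)
    moreover have "{h i, h j} - {0} \<subseteq> D" using hD[of i] hD[of j] ij by auto
    then have "a + \<Sum>({h i, h j} - {0}) \<in> {e. 2 * e \<in> A}"
      using a(1) unfolding cube_bases_def by blast
    ultimately have "2 * (a + (h i + h j)) \<in> A" by simp
    then show ?thesis by (simp add: algebra_simps)
  qed
  moreover have "inj_on ?b {1..k}" by (intro inj_onI) (simp add: inj_on_eq_iff[OF inj])
  ultimately show ?thesis unfolding pairwise_sums_in_def by (intro exI[of _ ?b]) auto
qed

section \<open>Existence of the thresholds and conclusion\<close>

text \<open>The integers are not well-ordered, so the minimum is obtained by shifting by the lower
  bound \<open>c\<close> into the naturals.\<close>

lemma Least_int_bounded_below: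
  fixes P :: "int \<Rightarrow> bool"
  assumes "P m" and lower: "\<And>x. P x \<Longrightarrow> x \<ge> c"
  shows "P (Least P)" "Least P \<le> m"
proof -
  define y where "y = (ARG_MIN (\<lambda>x. nat (x - c)) x. P x)"
  have y: "P y" "\<And>x. P x \<Longrightarrow> nat (y - c) \<le> nat (x - c)"
    unfolding y_def using arg_min_nat_lemma[of P m "\<lambda>x. nat (x - c)"] assms(1) by auto
  then have "y \<le> x" if "P x" for x using lower that by (smt (verit) nat_le_eq_zle)
  then have "Least P = y" using y(1) by (intro Least_equality)
  then show "P (Least P)" "Least P \<le> m" using y(1) \<open>\<And>x. P x \<Longrightarrow> y \<le> x\<close> assms(1) by auto
qed

theorem theorem10:
  fixes k :: nat
  assumes "k \<ge> 3"
  shows "\<exists>N::nat. N > 0 \<and> (\<forall>n\<ge>N. g_thr k n \<le> h_thr k n \<and>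
           real_of_int (h_thr k n) < 4 * real n powr (1 - 1 / 2 ^ (k - 2)))"
proof (intro exI[of _ "(8 * k + 4)\<^sup>2"] conjI allI impI)
  show "0 < (8 * k + 4)\<^sup>2" by simp
next
  fix n :: nat assume N: "n \<ge> (8 * k + 4)\<^sup>2"
  define G where "G = (\<lambda>m::int. \<forall>A \<subseteq> {1..2 * int n}. int (card A) \<ge> int n + m \<longrightarrow>
     (\<exists>b. pairwise_sums_in k b A))"
  define H where "H = (\<lambda>m::int. \<forall>A \<subseteq> {1..2 * int n}. int (card A) \<ge> int n + m \<longrightarrow>
     (\<exists>b. (\<forall>i\<in>{1..k}. b i > 0) \<and> pairwise_sums_in k b A))"
  define B where "B = 4 * real n powr (1 - 1 / 2 ^ (k - 2))"
  have HG: "G m" if "H m" for m using that unfolding G_def H_def by blast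
  \<comment> \<open>Below \<open>- n\<close> even the empty set meets the size condition, yet it
    contains no sum \<open>b 1 + b 2\<close>. This bound ensures that both minima exist.\<close>
  have lower: "m \<ge> - int n" if "G m" for m
  proof (rule ccontr)
    assume "\<not> m \<ge> - int n"
    then obtain b where "pairwise_sums_in k b {}" using \<open>G m\<close> unfolding G_def by force
    then have "b 1 + b 2 \<in> {}" using assms unfolding pairwise_sums_in_def
      by (elim conjE allE[of _ 1] allE[of _ 2]) auto
    then show False by simp
  qed
  \<comment> \<open>The largest integer strictly below \<open>B\<close>, which gives the strict
    inequality; rounding costs less than the \<open>1\<close> allowed for in
    \<open>hilbert_cube\<close>, or exactly \<open>1\<close> when \<open>B\<close> is an
    integer.\<close>
  have "H (\<lceil>B\<rceil> - 1)" unfolding H_def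
  proof (intro allI impI)
    fix A :: "int set" assume A: "A \<subseteq> {1..2 * int n}" "int n + (\<lceil>B\<rceil> - 1) \<le> int (card A)"
    let ?E = "{e. 2 * e \<in> A}"
    have E: "?E \<subseteq> {1..int n}" using A by fastforce
    have "\<lceil>B\<rceil> - 1 \<le> int (card ?E)" using A(2) card_halves[OF A(1)] by linarith
    then have "real (card ?E) \<ge> B - 1" by linarith
    then obtain D where D: "finite D" "card D = k - 1" "D \<subseteq> {0<..}" "cube_bases ?E D \<noteq> {}"
      using hilbert_cube[OF assms E N] unfolding B_def by blast
    then obtain a where a: "a \<in> cube_bases ?E D" by blast
    moreover have "a > 0" using a E cube_bases_subset[of ?E D] by fastforce
    ultimately show "\<exists>b. (\<forall>i\<in>{1..k}. b i > 0) \<and> pairwise_sums_in k b A"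
      using pairwise_sums_of_cube D assms by simp
  qed
  then have H: "H (h_thr k n)" "h_thr k n \<le> \<lceil>B\<rceil> - 1"
    using Least_int_bounded_below[of H _ "- int n"] HG lower
    unfolding h_thr_def H_def[symmetric] by blast+
  show "g_thr k n \<le> h_thr k n"
    using Least_int_bounded_below(2)[of G _ "- int n", OF HG[OF H(1)]] lower
    unfolding g_thr_def G_def[symmetric] by blast
  show "real_of_int (h_thr k n) < 4 * real n powr (1 - 1 / 2 ^ (k - 2))"
    using H(2) unfolding B_def[symmetric] by linarith
qed

end
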